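(* Let $p,q\ge 1$, $n=p+q$, and let $(AN)_{\mathrm{adm}}$ be the set of admissible elements of $AN\subset \mathrm{SL}(n,\mathbb{C})$ (with respect to $G_0=\mathrm{SU}(p,q)$). If $b_1,b_2\in (AN)_{\mathrm{adm}}$, then $b_1b_2\in (AN)_{\mathrm{adm}}$.
   Context: Let $p,q$ be positive integers and $n=p+q$. Equip $\mathbb{C}^n$ with the sesquilinear pairing $\langle \mathbf{x},\mathbf{y}\rangle=\sum_{i=1}^p x_i\bar y_i-\sum_{j=p+1}^n x_j\bar y_j$. $G_0=\mathrm{SU}(p,q)$ is the subgroup of $G=\mathrm{SL}(n,\mathbb{C})$ preserving this pairing. $A\subset G$ is the subgroup of diagonal matrices with positive real diagonal entries (and determinant 1), and $N\subset G$ is the subgroup of unipotent upper triangular matrices, so $AN$ is the group of upper triangular matrices in $G$ with positive real diagonal entries. Admissible elements of $A$: a matrix $\mathrm{diag}(\alpha_1,\dots,\alpha_p,\beta_1,\dots,\beta_q)\in A$ is admissible if $\alpha_i>\beta_j$ for all $1\le i\le p$, $1\le j\le q$. Right dressing action: for $b\in AN$ and $g\in G_0$, if there exist $b'\in AN$ and $g'\in G_0$ with $bg=g'b'$, one writes $b'=b^g$ (such $b'$ is unique since $G_0\cap AN=\{1\}$). Admissible elements of $AN$: $b\in AN$ is admissible if it is obtained from an admissible element of $A$ by the right dressing action, i.e. if there exist an admissible $a\in A$ and $g,g'\in G_0$ with $ag=g'b$. *)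

theory Defs
  imports Complex_Main "Jordan_Normal_Form.Determinant"
begin

(* Indices are 0-based: the coordinates written 1..p in the mathematics are {..<p},
   and p+1..n are {p..<p+q}. *)

definition pairing :: "nat \<Rightarrow> nat \<Rightarrow> complex vec \<Rightarrow> complex vec \<Rightarrow> complex" where
  "pairing p q x y =
     (\<Sum>i<p. x $ i * cnj (y $ i)) - (\<Sum>j = p..<p + q. x $ j * cnj (y $ j))"

definition SL :: "nat \<Rightarrow> complex mat set" where
  "SL n = {g \<in> carrier_mat n n. det g = 1}"

definition SU :: "nat \<Rightarrow> nat \<Rightarrow> complex mat set" where
  "SU p q = {g \<in> SL (p + q).
     \<forall>x \<in> carrier_vec (p + q). \<forall>y \<in> carrier_vec (p + q).
       pairing p q (g *\<^sub>v x) (g *\<^sub>v y) = pairing p q x y}"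

definition pos_real_diag :: "complex mat \<Rightarrow> bool" where
  "pos_real_diag b \<longleftrightarrow> (\<forall>i < dim_row b. b $$ (i, i) \<in> \<real> \<and> 0 < Re (b $$ (i, i)))"

definition A_group :: "nat \<Rightarrow> complex mat set" where
  "A_group n = {a \<in> SL n. diagonal_mat a \<and> pos_real_diag a}"

definition AN_group :: "nat \<Rightarrow> complex mat set" where
  "AN_group n = {b \<in> SL n. upper_triangular b \<and> pos_real_diag b}"

(* Entries of elements of A are real, so comparing real parts compares the entries. *)
definition A_adm :: "nat \<Rightarrow> nat \<Rightarrow> complex mat set" where
  "A_adm p q = {a \<in> A_group (p + q).
     \<forall>i < p. \<forall>j \<in> {p..<p + q}. Re (a $$ (i, i)) > Re (a $$ (j, j))}"

(* The right dressing action is only partially defined, so b' = b^g is rendered as the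
   relation dressing p q b g b'. *)
definition dressing ::
  "nat \<Rightarrow> nat \<Rightarrow> complex mat \<Rightarrow> complex mat \<Rightarrow> complex mat \<Rightarrow> bool" where
  "dressing p q b g b' \<longleftrightarrow>
     b \<in> AN_group (p + q) \<and> g \<in> SU p q \<and> b' \<in> AN_group (p + q) \<and>
     (\<exists>g' \<in> SU p q. b * g = g' * b')"

definition AN_adm :: "nat \<Rightarrow> nat \<Rightarrow> complex mat set" where
  "AN_adm p q = {b. \<exists>a \<in> A_adm p q. \<exists>g. dressing p q a g b}"

end

theory Submission
  imports Defs "Jordan_Normal_Form.Spectral_Radius"
begin

text \<open>Let \<open>J\<close> be the diagonal matrix of the pairing. An element \<open>b\<close> of \<open>AN\<close> is admissible iff
  for some \<open>l > 0\<close> the Hermitian form \<open>\<langle>bx, bx\<rangle> - l \<langle>x, x\<rangle>\<close> is positive definite, and this property is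
  inherited by products, since \<open>\<langle>b\<^sub>1b\<^sub>2x, b\<^sub>1b\<^sub>2x\<rangle> > l\<^sub>1\<langle>b\<^sub>2x, b\<^sub>2x\<rangle> > l\<^sub>1l\<^sub>2\<langle>x, x\<rangle>\<close>.
  For an admissible \<open>a\<close> in \<open>A\<close>, take \<open>l\<close> between the squares of the two groups of entries; the dressing
  action preserves the condition. Conversely, a definite form in the pencil of \<open>J\<close> and \<open>b\<^sup>*Jb\<close> allows
  both to be diagonalized by one congruence. By Sylvester's law of inertia the diagonal forms
  have \<open>p\<close> positive and \<open>q\<close> negative entries, at the same places, so after permuting and rescaling the
  congruence lies in \<open>SU(p,q)\<close> and takes \<open>b\<^sup>*Jb\<close> to \<open>Ja\<^sup>2\<close> with \<open>a\<close> admissible.\<close>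

section \<open>Adjoints of complex matrices\<close>

lemma mat_adjoint_dim [simp]:
  "dim_row (mat_adjoint A) = dim_col A" "dim_col (mat_adjoint A) = dim_row A"
  by (simp_all add: mat_adjoint_def)

lemma mat_adjoint_carrier [simp]:
  "A \<in> carrier_mat n m \<Longrightarrow> mat_adjoint A \<in> carrier_mat m n"
  by (auto intro: carrier_matI)

lemma congruence_carrier [simp]:
  "A \<in> carrier_mat n m \<Longrightarrow> mat_adjoint A * M * A \<in> carrier_mat m m"
  by (auto intro: carrier_matI)

lemma mat_adjoint_index [simp]:
  fixes A :: "complex mat"
  assumes "i < dim_col A" "j < dim_row A"
  shows "mat_adjoint A $$ (i, j) = cnj (A $$ (j, i))"
  using assms by (simp add: mat_adjoint_def mat_of_rows_index)

lemma mat_adjoint_adjoint [simp]: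
  fixes A :: "complex mat"
  shows "mat_adjoint (mat_adjoint A) = A"
  by (rule eq_matI) auto

lemma mat_adjoint_mult:
  fixes A B :: "complex mat"
  assumes "A \<in> carrier_mat n m" "B \<in> carrier_mat m k"
  shows "mat_adjoint (A * B) = mat_adjoint B * mat_adjoint A"
proof (rule eq_matI)
  fix i j assume "i < dim_row (mat_adjoint B * mat_adjoint A)" "j < dim_col (mat_adjoint B * mat_adjoint A)"
  then have i: "i < k" and j: "j < n" using assms by auto
  have "mat_adjoint (A * B) $$ (i, j) = cnj (\<Sum>l<m. A $$ (j, l) * B $$ (l, i))"
    using assms i j by (simp add: scalar_prod_def atLeast0LessThan)
  also have "\<dots> = (\<Sum>l<m. mat_adjoint B $$ (i, l) * mat_adjoint A $$ (l, j))"
    using assms i j by (simp add: mult.commute)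
  also have "\<dots> = (mat_adjoint B * mat_adjoint A) $$ (i, j)"
    using assms i j by (simp add: scalar_prod_def atLeast0LessThan)
  finally show "mat_adjoint (A * B) $$ (i, j) = (mat_adjoint B * mat_adjoint A) $$ (i, j)" .
qed (use assms in auto)

lemma det_mat_adjoint:
  fixes A :: "complex mat"
  assumes "A \<in> carrier_mat n n"
  shows "det (mat_adjoint A) = cnj (det A)"
proof -
  interpret cnj: comm_ring_hom cnj
    by unfold_locales auto
  have "mat_adjoint A = transpose_mat (map_mat cnj A)"
    by (rule eq_matI) auto
  then have "det (mat_adjoint A) = det (map_mat cnj A)"
    using assms det_transpose[of "map_mat cnj A" n] by simp
  then show ?thesis by (simp add: cnj.hom_det)
qed

section \<open>Sesquilinear forms given by matrices\<close>

definition sesq :: "complex mat \<Rightarrow> complex vec \<Rightarrow> complex vec \<Rightarrow> complex" where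
  "sesq M x y = (M *\<^sub>v x) \<bullet>c y"

text \<open>The adjoint moves across the inner product, so a congruence amounts to substituting
  \<open>A *\<^sub>v x\<close> into the form. \<open>A\<close> may be rectangular, which is how a
  form is later restricted to a hyperplane.\<close>

lemma sesq_congruence:
  assumes A: "A \<in> carrier_mat n m" and M: "M \<in> carrier_mat n n"
    and x: "x \<in> carrier_vec m" and y: "y \<in> carrier_vec m"
  shows "sesq (mat_adjoint A * M * A) x y = sesq M (A *\<^sub>v x) (A *\<^sub>v y)"
proof -
  define z where "z = M *\<^sub>v (A *\<^sub>v x)"
  have z: "z \<in> carrier_vec n" using A M x by (simp add: z_def)
  have adj: "mat_adjoint A = transpose_mat (map_mat cnj A)"
    by (rule eq_matI) auto
  have "(mat_adjoint A * M * A) *\<^sub>v x = mat_adjoint A *\<^sub>v z"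
    unfolding z_def using assms
    by (simp add: assoc_mult_mat_vec[of "mat_adjoint A * M" m n A m]
        assoc_mult_mat_vec[of "mat_adjoint A" m n M n] mult_carrier_mat[of _ m n M n])
  moreover have "(mat_adjoint A *\<^sub>v z) \<bullet>c y = z \<bullet> (map_mat cnj A *\<^sub>v conjugate y)"
    unfolding adj using A y z
    by (intro transpose_vec_mult_scalar[of _ n m]) auto
  moreover have "map_mat cnj A *\<^sub>v conjugate y = conjugate (A *\<^sub>v y)"
    using A y by (intro eq_vecI) (auto simp: scalar_prod_def intro!: sum.cong)
  ultimately show ?thesis by (simp add: sesq_def z_def)
qed

lemma sesq_eq_sum:
  assumes "M \<in> carrier_mat n n" "x \<in> carrier_vec n" "y \<in> carrier_vec n"
  shows "sesq M x y = (\<Sum>i<n. \<Sum>j<n. M $$ (i, j) * x $ j * cnj (y $ i))"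
  using assms by (auto simp: sesq_def scalar_prod_def sum_distrib_right atLeast0LessThan intro!: sum.cong)

lemma sesq_hermitian:
  assumes M: "M \<in> carrier_mat n n" "mat_adjoint M = M"
    and x: "x \<in> carrier_vec n" and y: "y \<in> carrier_vec n"
  shows "sesq M y x = cnj (sesq M x y)"
proof -
  have h: "cnj (M $$ (i, j)) = M $$ (j, i)" if "i < n" "j < n" for i j
    using mat_adjoint_index[of j M i] M that by simp
  have "cnj (sesq M x y) = (\<Sum>i<n. \<Sum>j<n. cnj (M $$ (i, j)) * cnj (x $ j) * y $ i)"
    using M x y by (simp add: sesq_eq_sum)
  also have "\<dots> = (\<Sum>i<n. \<Sum>j<n. M $$ (j, i) * cnj (x $ j) * y $ i)"
    by (intro sum.cong) (auto simp: h)
  also have "\<dots> = (\<Sum>j<n. \<Sum>i<n. M $$ (j, i) * cnj (x $ j) * y $ i)"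
    by (rule sum.swap)
  also have "\<dots> = sesq M y x"
    using M x y by (auto simp: sesq_eq_sum mult_ac intro!: sum.cong)
  finally show ?thesis by simp
qed

lemma sesq_smult:
  assumes "M \<in> carrier_mat n n" "x \<in> carrier_vec n" "y \<in> carrier_vec n"
  shows "sesq M (a \<cdot>\<^sub>v x) y = a * sesq M x y" "sesq M x (a \<cdot>\<^sub>v y) = cnj a * sesq M x y"
  using assms by (auto simp: sesq_eq_sum sum_distrib_left mult_ac intro!: sum.cong)

lemma mult_mat_unit_vec:
  fixes M :: "'a :: semiring_1 mat"
  assumes "M \<in> carrier_mat m n" "j < n"
  shows "M *\<^sub>v unit_vec n j = col M j"
  using assms by (intro eq_vecI) auto

lemma sesq_unit_vec:
  assumes M: "M \<in> carrier_mat n n" and ij: "i < n" "j < n"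
  shows "sesq M (unit_vec n j) (unit_vec n i) = M $$ (i, j)"
proof -
  have "conjugate (unit_vec n i) = (unit_vec n i :: complex vec)"
    by (intro eq_vecI) (auto simp: unit_vec_def)
  moreover have "col M j \<bullet> unit_vec n i = col M j $ i"
    using M ij by (intro scalar_prod_right_unit) auto
  ultimately show ?thesis
    using M ij by (simp add: sesq_def mult_mat_unit_vec[OF M])
qed

lemma sesq_mat_diag:
  assumes "x \<in> carrier_vec n" "y \<in> carrier_vec n"
  shows "sesq (mat_diag n d) x y = (\<Sum>i<n. d i * x $ i * cnj (y $ i))"
proof -
  have "(\<Sum>j<n. mat_diag n d $$ (i, j) * x $ j * cnj (y $ i)) = d i * x $ i * cnj (y $ i)"
    if "i < n" for i
  proof -
    have "(\<Sum>j<n. mat_diag n d $$ (i, j) * x $ j * cnj (y $ i)) =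
        (\<Sum>j<n. if j = i then d j * x $ j * cnj (y $ i) else 0)"
      using that by (intro sum.cong) (auto simp: mat_diag_def)
    then show ?thesis using that by simp
  qed
  then show ?thesis
    using assms by (subst sesq_eq_sum[of _ n]) simp_all
qed

text \<open>Unit vectors read off the entries. Matrix identities can thus be checked on forms, where
  congruence is mere substitution.\<close>

lemma eq_mat_sesqI:
  assumes "M \<in> carrier_mat n n" "N \<in> carrier_mat n n"
    and "\<And>x y. x \<in> carrier_vec n \<Longrightarrow> y \<in> carrier_vec n \<Longrightarrow> sesq M x y = sesq N x y"
  shows "M = N"
  using assms by (intro eq_matI) (auto simp: sesq_unit_vec[symmetric, of _ n])

text \<open>A congruence produces the Gram matrix of the columns of \<open>S\<close>. The indices
  are swapped because \<open>sesq\<close> applies the matrix to its first argument, so the column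
  index of an entry belongs to that argument.\<close>

lemma sesq_mat_of_cols:
  assumes S: "S \<in> carrier_mat n n" and M: "M \<in> carrier_mat n n" and "i < n" "j < n"
  shows "(mat_adjoint S * M * S) $$ (i, j) = sesq M (col S j) (col S i)"
proof -
  have c: "S *\<^sub>v unit_vec n k = col S k" if "k < n" for k
    using mult_mat_unit_vec[OF S that] .
  have "(mat_adjoint S * M * S) $$ (i, j) =
      sesq (mat_adjoint S * M * S) (unit_vec n j) (unit_vec n i)"
    using assms by (intro sesq_unit_vec[symmetric]) auto
  then show ?thesis
    using assms by (simp add: sesq_congruence[of _ n n] c)
qed

lemma mat_adjoint_congruence_eq_self:
  fixes A M :: "complex mat"
  assumes "A \<in> carrier_mat n m" "M \<in> carrier_mat n n" "mat_adjoint M = M"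
  shows "mat_adjoint (mat_adjoint A * M * A) = mat_adjoint A * M * A"
proof -
  have AM: "mat_adjoint A * M \<in> carrier_mat m n"
    using assms by (intro mult_carrier_mat[of _ m n]) auto
  have "mat_adjoint (mat_adjoint A * M * A) = mat_adjoint A * mat_adjoint (mat_adjoint A * M)"
    by (rule mat_adjoint_mult[OF AM assms(1)])
  also have "mat_adjoint (mat_adjoint A * M) = M * A"
    using mat_adjoint_mult[of "mat_adjoint A" m n M n] assms by simp
  also have "mat_adjoint A * (M * A) = mat_adjoint A * M * A"
    using assms by (intro assoc_mult_mat[symmetric, of _ m n _ n _ m]) auto
  finally show ?thesis .
qed

section \<open>Simultaneous diagonalization of a definite and a Hermitian form\<close>

definition pos_def :: "nat \<Rightarrow> complex mat \<Rightarrow> bool" where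
  "pos_def n P \<longleftrightarrow> P \<in> carrier_mat n n \<and> mat_adjoint P = P \<and>
     (\<forall>x \<in> carrier_vec n. x \<noteq> 0\<^sub>v n \<longrightarrow> Re (sesq P x x) > 0)"

text \<open>Definiteness makes \<open>P\<close> invertible. In positive dimension the inverse of
  \<open>P\<close> times \<open>A\<close> has an eigenvector over the complex numbers, and this
  vector solves the generalized eigenvalue problem.\<close>

lemma pos_def_pencil_eigenvector:
  assumes P: "pos_def n P" and A: "A \<in> carrier_mat n n" and n: "n > 0"
  obtains v d where "v \<in> carrier_vec n" "v \<noteq> 0\<^sub>v n" "A *\<^sub>v v = d \<cdot>\<^sub>v (P *\<^sub>v v)"
proof -
  have Pc: "P \<in> carrier_mat n n" using P by (simp add: pos_def_def)
  have "det P \<noteq> 0"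
  proof
    assume "det P = 0"
    then obtain v where v: "v \<in> carrier_vec n" "v \<noteq> 0\<^sub>v n" "P *\<^sub>v v = 0\<^sub>v n"
      using det_0_iff_vec_prod_zero[OF Pc] by auto
    then have "sesq P v v = 0" by (simp add: sesq_def)
    with P v show False by (auto simp: pos_def_def)
  qed
  then obtain Q where Q: "Q \<in> carrier_mat n n" "P * Q = 1\<^sub>m n"
    using det_non_zero_imp_unit[OF Pc] by (auto simp: Units_def ring_mat_def)
  have "spectrum (Q * A) \<noteq> {}"
    using Q A n by (intro spectrum_non_empty[of _ n]) auto
  then obtain d v where dv: "eigenvector (Q * A) v d"
    by (auto simp: spectrum_def eigenvalue_def)
  then have v: "v \<in> carrier_vec n" "v \<noteq> 0\<^sub>v n" and e: "(Q * A) *\<^sub>v v = d \<cdot>\<^sub>v v"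
    using Q A by (auto simp: eigenvector_def)
  have "A *\<^sub>v v = (P * Q) *\<^sub>v (A *\<^sub>v v)"
    using A v Q(2) by simp
  also have "\<dots> = P *\<^sub>v ((Q * A) *\<^sub>v v)"
    using A v Q(1) Pc by (simp add: assoc_mult_mat_vec[of _ n n _ n])
  also have "\<dots> = d \<cdot>\<^sub>v (P *\<^sub>v v)"
    unfolding e using Pc v by (intro mult_mat_vec) auto
  finally show ?thesis using v that by blast
qed

text \<open>The vectors \<open>e\<^sub>i - c\<^sub>i v\<close>, where \<open>i\<close> omits an index at which \<open>v\<close> does not vanish,
  form a basis of the hyperplane orthogonal to \<open>z\<close>.\<close>

lemma orthogonal_hyperplane_basis:
  fixes v z :: "complex vec"
  assumes v: "v \<in> carrier_vec (Suc n)" and z: "z \<in> carrier_vec (Suc n)" and zv: "z \<bullet>c v = 1"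
  obtains W where "W \<in> carrier_mat (Suc n) n"
    "\<And>x. x \<in> carrier_vec n \<Longrightarrow> z \<bullet>c (W *\<^sub>v x) = 0"
    "\<And>x. x \<in> carrier_vec n \<Longrightarrow> W *\<^sub>v x = 0\<^sub>v (Suc n) \<Longrightarrow> x = 0\<^sub>v n"
proof -
  obtain k where k: "k < Suc n" "v $ k \<noteq> 0"
  proof (rule ccontr)
    assume "\<not> thesis"
    with that v have "v = 0\<^sub>v (Suc n)" by (intro eq_vecI) auto
    with zv z show False by simp
  qed
  \<comment> \<open>\<open>I\<close> enumerates the indices below \<open>Suc n\<close> other than
    \<open>k\<close>.\<close>
  define I where "I j = (if j < k then j else Suc j)" for j
  have I: "I j < Suc n" "I j \<noteq> k" if "j < n" for j
    using that by (auto simp: I_def)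
  have Iinj: "I i = I j \<longleftrightarrow> i = j" for i j
    by (auto simp: I_def split: if_splits)
  \<comment> \<open>Column \<open>j\<close> is the unit vector at \<open>I j\<close> minus the
    multiple of \<open>v\<close> that makes it orthogonal to \<open>z\<close>; the coefficient is
    \<open>cnj (z $ I j)\<close> because \<open>z \<bullet>c v = 1\<close>.\<close>
  define W where "W = mat (Suc n) n (\<lambda>(i, j). (if i = I j then 1 else 0) - cnj (z $ I j) * v $ i)"
  have W: "W \<in> carrier_mat (Suc n) n" by (simp add: W_def)
  have Wx: "(W *\<^sub>v x) $ i = (\<Sum>j<n. if i = I j then x $ j else 0)
      - v $ i * (\<Sum>j<n. cnj (z $ I j) * x $ j)"
    if "x \<in> carrier_vec n" "i < Suc n" for x i
  proof -
    have "(W *\<^sub>v x) $ i = (\<Sum>j<n. ((if i = I j then 1 else 0) - cnj (z $ I j) * v $ i) * x $ j)"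
      using that by (auto simp: W_def scalar_prod_def atLeast0LessThan)
    also have "\<dots> = (\<Sum>j<n. (if i = I j then x $ j else 0) - v $ i * (cnj (z $ I j) * x $ j))"
      by (intro sum.cong) (auto simp: algebra_simps)
    finally show ?thesis by (simp add: sum_subtractf sum_distrib_left)
  qed
  have zv': "(\<Sum>i<Suc n. z $ i * cnj (v $ i)) = 1"
    using zv v by (simp add: scalar_prod_def atLeast0LessThan)
  show ?thesis
  proof (rule that[OF W])
    fix x :: "complex vec" assume x: "x \<in> carrier_vec n"
    define s where "s = (\<Sum>j<n. cnj (z $ I j) * x $ j)"
    have "z \<bullet>c (W *\<^sub>v x) = (\<Sum>i<Suc n. z $ i * cnj ((W *\<^sub>v x) $ i))"
      using W by (simp add: scalar_prod_def atLeast0LessThan)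
    also have "\<dots> = (\<Sum>i<Suc n. (\<Sum>j<n. if i = I j then z $ i * cnj (x $ j) else 0)
        - z $ i * cnj (v $ i) * cnj s)"
      by (intro sum.cong)
        (auto simp del: sum.lessThan_Suc simp: Wx[OF x] s_def[symmetric] right_diff_distrib sum_distrib_left
          intro!: sum.cong)
    also have "\<dots> = (\<Sum>i<Suc n. \<Sum>j<n. if i = I j then z $ i * cnj (x $ j) else 0) - cnj s"
      using zv' by (simp only: sum_subtractf sum_distrib_right[symmetric] mult_1_left)
    also have "(\<Sum>i<Suc n. \<Sum>j<n. if i = I j then z $ i * cnj (x $ j) else 0) =
        (\<Sum>j<n. \<Sum>i<Suc n. if i = I j then z $ i * cnj (x $ j) else 0)"
      by (rule sum.swap)
    also have "\<dots> = (\<Sum>j<n. z $ I j * cnj (x $ j))"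
      using I by (intro sum.cong) (simp_all del: sum.lessThan_Suc)
    also have "\<dots> = cnj s" by (simp add: s_def)
    finally show "z \<bullet>c (W *\<^sub>v x) = 0" by simp
  next
    fix x :: "complex vec" assume x: "x \<in> carrier_vec n" and 0: "W *\<^sub>v x = 0\<^sub>v (Suc n)"
    define s where "s = (\<Sum>j<n. cnj (z $ I j) * x $ j)"
    have eq: "0 = (\<Sum>j<n. if i = I j then x $ j else 0) - v $ i * s" if "i < Suc n" for i
      using Wx[OF x that] that 0 by (simp add: s_def)
    \<comment> \<open>Coordinate \<open>k\<close> of \<open>W *\<^sub>v x\<close> sees only the
      multiple of \<open>v\<close>. As \<open>v $ k\<close> is nonzero, \<open>s\<close> vanishes,
      and then the remaining coordinates are those of \<open>x\<close>.\<close>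
    have "(\<Sum>j<n. if k = I j then x $ j else 0) = 0"
      using I(2) by (intro sum.neutral) auto
    then have "s = 0" using eq[OF k(1)] k(2) by simp
    then have "x $ j = 0" if "j < n" for j
      using eq[OF I(1)[OF that]] that by (simp add: Iinj)
    then show "x = 0\<^sub>v n" using x by (intro eq_vecI) auto
  qed
qed

text \<open>Induction on the dimension. A pencil eigenvector \<open>v\<close> has \<open>A v\<close>
  proportional to \<open>P v\<close>, so every vector that is \<open>P\<close>-orthogonal to
  \<open>v\<close> is also \<open>A\<close>-orthogonal to it. The induction hypothesis is applied to
  both forms restricted to the hyperplane of these vectors.\<close>

lemma simultaneous_orthogonal_basis:
  assumes "pos_def n P" "A \<in> carrier_mat n n" "mat_adjoint A = A"
  shows "\<exists>u. (\<forall>i<n. u i \<in> carrier_vec n) \<and>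
    (\<forall>i<n. \<forall>j<n. sesq P (u i) (u j) = (if i = j then 1 else 0) \<and>
      (i \<noteq> j \<longrightarrow> sesq A (u i) (u j) = 0))"
  using assms
proof (induction n arbitrary: P A)
  case 0
  show ?case by simp
next
  case (Suc n)
  note PD = Suc.prems(1) and A = Suc.prems(2,3)
  have P: "P \<in> carrier_mat (Suc n) (Suc n)" "mat_adjoint P = P" using PD by (auto simp: pos_def_def)
  obtain w d where w: "w \<in> carrier_vec (Suc n)" "w \<noteq> 0\<^sub>v (Suc n)"
    and wd: "A *\<^sub>v w = d \<cdot>\<^sub>v (P *\<^sub>v w)"
    using pos_def_pencil_eigenvector[OF PD A(1)] by auto
  define r where "r = Re (sesq P w w)"
  have r: "r > 0" using PD w by (simp add: pos_def_def r_def)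
  have "cnj (sesq P w w) = sesq P w w" using sesq_hermitian[OF P w(1) w(1)] by simp
  then have rr: "sesq P w w = complex_of_real r" by (simp add: r_def complex_eq_iff)
  \<comment> \<open>Rescaling to \<open>sesq P v v = 1\<close> serves the orthonormality claim and
    is also the normalization that \<open>orthogonal_hyperplane_basis\<close> expects for
    \<open>z = P *\<^sub>v v\<close>.\<close>
  define v where "v = complex_of_real (1 / sqrt r) \<cdot>\<^sub>v w"
  have v: "v \<in> carrier_vec (Suc n)" using w by (simp add: v_def)
  have "complex_of_real (1 / sqrt r) * (complex_of_real (1 / sqrt r) * complex_of_real r)
      = complex_of_real (1 / sqrt r * (1 / sqrt r * r))"
    by (simp only: of_real_mult)
  also have "1 / sqrt r * (1 / sqrt r * r) = 1"
    using r by (simp add: field_simps)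
  finally have vv: "sesq P v v = 1"
    using P w by (simp add: v_def sesq_smult[of _ "Suc n"] rr)
  have Av: "A *\<^sub>v v = d \<cdot>\<^sub>v (P *\<^sub>v v)"
    using P A w wd by (simp add: v_def mult_mat_vec[of _ "Suc n" "Suc n"] smult_smult_assoc mult.commute)
  have Pv: "P *\<^sub>v v \<in> carrier_vec (Suc n)" using P v by simp
  obtain W where W: "W \<in> carrier_mat (Suc n) n"
    and orth: "\<And>x. x \<in> carrier_vec n \<Longrightarrow> (P *\<^sub>v v) \<bullet>c (W *\<^sub>v x) = 0"
    and inj: "\<And>x. x \<in> carrier_vec n \<Longrightarrow> W *\<^sub>v x = 0\<^sub>v (Suc n) \<Longrightarrow> x = 0\<^sub>v n"
    using orthogonal_hyperplane_basis[OF v Pv] vv by (auto simp: sesq_def)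
  have PW: "sesq P v (W *\<^sub>v x) = 0" "sesq A v (W *\<^sub>v x) = 0"
      "sesq P (W *\<^sub>v x) v = 0" "sesq A (W *\<^sub>v x) v = 0" if x: "x \<in> carrier_vec n" for x :: "complex vec"
  proof -
    have Wx: "W *\<^sub>v x \<in> carrier_vec (Suc n)" using W x by simp
    show 1: "sesq P v (W *\<^sub>v x) = 0" using orth[OF x] by (simp add: sesq_def)
    show 2: "sesq A v (W *\<^sub>v x) = 0"
      using orth[OF x] Pv Wx by (simp add: sesq_def Av smult_scalar_prod_distrib[of _ "Suc n"])
    show "sesq P (W *\<^sub>v x) v = 0" using sesq_hermitian[OF P v Wx] 1 by simp
    show "sesq A (W *\<^sub>v x) v = 0" using sesq_hermitian[OF A v Wx] 2 by simp
  qed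
  define P' A' where "P' = mat_adjoint W * P * W" and "A' = mat_adjoint W * A * W"
  have c: "sesq P' x y = sesq P (W *\<^sub>v x) (W *\<^sub>v y)" "sesq A' x y = sesq A (W *\<^sub>v x) (W *\<^sub>v y)"
    if "x \<in> carrier_vec n" "y \<in> carrier_vec n" for x y
    using that W P A by (simp_all add: P'_def A'_def sesq_congruence[of _ "Suc n" n])
  \<comment> \<open>Definiteness survives the restriction because \<open>W\<close> is
    injective.\<close>
  have "pos_def n P'"
    unfolding pos_def_def
  proof (intro conjI ballI impI)
    show "P' \<in> carrier_mat n n" using W P by (simp add: P'_def)
    show "mat_adjoint P' = P'" unfolding P'_def by (rule mat_adjoint_congruence_eq_self[OF W P])
    fix x :: "complex vec" assume x: "x \<in> carrier_vec n" "x \<noteq> 0\<^sub>v n"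
    then have "W *\<^sub>v x \<in> carrier_vec (Suc n)" "W *\<^sub>v x \<noteq> 0\<^sub>v (Suc n)" using W inj by auto
    then show "Re (sesq P' x x) > 0" using PD x by (simp add: c pos_def_def)
  qed
  moreover have "A' \<in> carrier_mat n n" using W A by (simp add: A'_def)
  moreover have "mat_adjoint A' = A'" unfolding A'_def by (rule mat_adjoint_congruence_eq_self[OF W A])
  ultimately obtain u where u: "\<And>i. i < n \<Longrightarrow> u i \<in> carrier_vec n"
    and uu: "\<And>i j. i < n \<Longrightarrow> j < n \<Longrightarrow> sesq P' (u i) (u j) = (if i = j then 1 else 0)"
      "\<And>i j. i < n \<Longrightarrow> j < n \<Longrightarrow> i \<noteq> j \<Longrightarrow> sesq A' (u i) (u j) = 0"
    using Suc.IH[of P' A'] by blast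
  define u' where "u' i = (case i of 0 \<Rightarrow> v | Suc j \<Rightarrow> W *\<^sub>v u j)" for i
  show ?case
  proof (intro exI[of _ u'] conjI allI impI)
    show "u' i \<in> carrier_vec (Suc n)" if "i < Suc n" for i
      using that v W u by (auto simp: u'_def split: nat.split)
    show "sesq P (u' i) (u' j) = (if i = j then 1 else 0)" if "i < Suc n" "j < Suc n" for i j
      using that vv PW u uu(1) by (auto simp: u'_def c split: nat.split)
    show "sesq A (u' i) (u' j) = 0" if "i < Suc n" "j < Suc n" "i \<noteq> j" for i j
      using that PW u uu(2) by (auto simp: u'_def c split: nat.split)
  qed
qed

text \<open>The basis vectors become the columns of \<open>S\<close>. The diagonal values of a
  Hermitian form are real, so \<open>d\<close> can be real-valued, which the counting of signs below
  relies on.\<close>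

lemma simultaneous_diagonalization:
  assumes P: "pos_def n P" and A: "A \<in> carrier_mat n n" "mat_adjoint A = A"
  obtains S d where "S \<in> carrier_mat n n" "mat_adjoint S * P * S = 1\<^sub>m n"
    "mat_adjoint S * A * S = mat_diag n (\<lambda>i. complex_of_real (d i))"
proof -
  obtain u where u: "\<And>i. i < n \<Longrightarrow> u i \<in> carrier_vec n"
    and uu: "\<And>i j. i < n \<Longrightarrow> j < n \<Longrightarrow> sesq P (u i) (u j) = (if i = j then 1 else 0)"
      "\<And>i j. i < n \<Longrightarrow> j < n \<Longrightarrow> i \<noteq> j \<Longrightarrow> sesq A (u i) (u j) = 0"
    using simultaneous_orthogonal_basis[OF assms] by blast
  define S where "S = mat n n (\<lambda>(i, j). u j $ i)"
  have S: "S \<in> carrier_mat n n" by (simp add: S_def)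
  have cS: "col S j = u j" if "j < n" for j
    using u[OF that] that by (intro eq_vecI) (auto simp: S_def)
  have Pc: "P \<in> carrier_mat n n" using P by (simp add: pos_def_def)
  have real: "complex_of_real (Re (sesq A (u i) (u i))) = sesq A (u i) (u i)" if "i < n" for i
    using sesq_hermitian[OF A u[OF that] u[OF that]] by (simp add: complex_eq_iff)
  have e: "(mat_adjoint S * P * S) $$ (i, j) = sesq P (u j) (u i)"
    "(mat_adjoint S * A * S) $$ (i, j) = sesq A (u j) (u i)" if "i < n" "j < n" for i j
    using sesq_mat_of_cols[OF S Pc that] sesq_mat_of_cols[OF S A(1) that] that by (simp_all add: cS)
  show ?thesis
  proof (rule that[OF S])
    show "mat_adjoint S * P * S = 1\<^sub>m n"
      by (rule eq_matI) (use S uu(1) e in auto)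
    show "mat_adjoint S * A * S = mat_diag n (\<lambda>i. complex_of_real (Re (sesq A (u i) (u i))))"
      by (rule eq_matI) (use S uu(2) e real in \<open>auto simp: mat_diag_def\<close>)
  qed
qed

section \<open>Sylvester's law of inertia\<close>

lemma det_mat_diag:
  fixes f :: "nat \<Rightarrow> 'a :: comm_ring_1"
  shows "det (mat_diag n f) = (\<Prod>i<n. f i)"
proof -
  have "det (mat_diag n f) = prod_list (diag_mat (mat_diag n f))"
    by (rule det_upper_triangular[of _ n]) (auto simp: mat_diag_def)
  also have "diag_mat (mat_diag n f) = map f [0..<n]"
    by (auto simp: diag_mat_def mat_diag_def)
  also have "prod_list (map f [0..<n]) = (\<Prod>i<n. f i)"
    by (simp add: atLeast0LessThan flip: prod.distinct_set_conv_list)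
  finally show ?thesis .
qed

text \<open>Padding the coefficient rows with zero rows gives a square matrix. There are fewer than
  \<open>n\<close> equations, so its last row is zero, its determinant vanishes, and its kernel
  supplies \<open>x\<close>.\<close>

lemma underdetermined_system:
  fixes cs :: "'a :: field vec list"
  assumes cs: "set cs \<subseteq> carrier_vec n" and len: "length cs < n"
  obtains x where "x \<in> carrier_vec n" "x \<noteq> 0\<^sub>v n" "\<And>c. c \<in> set cs \<Longrightarrow> c \<bullet> x = 0"
proof -
  define M where "M = mat n n (\<lambda>(i, j). if i < length cs then cs ! i $ j else 0)"
  have M: "M \<in> carrier_mat n n" by (simp add: M_def)
  have "transpose_mat M *\<^sub>v unit_vec n (n - 1) = row M (n - 1)"
    using M len by (subst mult_mat_unit_vec[of _ n n]) auto
  also have "\<dots> = 0\<^sub>v n"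
    using len by (intro eq_vecI) (auto simp: M_def)
  finally have "transpose_mat M *\<^sub>v unit_vec n (n - 1) = 0\<^sub>v n" .
  moreover have "unit_vec n (n - 1) \<noteq> (0\<^sub>v n :: 'a vec)"
    using len by simp
  ultimately have "det (transpose_mat M) = 0"
    using M by (subst det_0_iff_vec_prod_zero[of _ n]) (auto intro!: exI[of _ "unit_vec n (n - 1)"])
  then have "det M = 0" using M by (simp add: det_transpose)
  then obtain x where x: "x \<in> carrier_vec n" "x \<noteq> 0\<^sub>v n" "M *\<^sub>v x = 0\<^sub>v n"
    using det_0_iff_vec_prod_zero[OF M] by auto
  have "cs ! i \<bullet> x = 0" if i: "i < length cs" for i
  proof -
    have "row M i = cs ! i"
    proof -
      have "cs ! i \<in> carrier_vec n" using cs nth_mem[OF i] by blast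
      then show ?thesis using i len by (intro eq_vecI) (auto simp: M_def)
    qed
    then have "cs ! i \<bullet> x = (M *\<^sub>v x) $ i"
      using i len M by simp
    also have "\<dots> = 0" using i len x by simp
    finally show ?thesis .
  qed
  then show ?thesis using that x(1,2) by (metis in_set_conv_nth)
qed

text \<open>Suppose \<open>d\<close> had fewer positive values than \<open>e\<close>. Demanding that
  \<open>S *\<^sub>v x\<close> vanish where \<open>d\<close> is positive and that \<open>x\<close>
  vanish where \<open>e\<close> is not positive imposes fewer than \<open>n\<close> linear
  conditions. A nonzero solution would make the left sum nonpositive and the right sum
  positive.\<close>

lemma inertia_le:
  fixes d e :: "nat \<Rightarrow> real"
  assumes S: "S \<in> carrier_mat n n"
    and form: "\<And>x. x \<in> carrier_vec n \<Longrightarrow>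
      (\<Sum>i<n. d i * (cmod ((S *\<^sub>v x) $ i))\<^sup>2) = (\<Sum>i<n. e i * (cmod (x $ i))\<^sup>2)"
  shows "card {i. i < n \<and> e i > 0} \<le> card {i. i < n \<and> d i > 0}"
proof (rule ccontr)
  assume less: "\<not> ?thesis"
  \<comment> \<open>Zeros of \<open>e\<close> are included, so that \<open>E\<close> is the exact
    complement of the positive places and the count below adds up to \<open>n\<close>.\<close>
  define E where "E = {i. i < n \<and> \<not> e i > 0}"
  define D where "D = {i. i < n \<and> d i > 0}"
  have fin: "finite E" "finite D" by (auto simp: E_def D_def)
  define cs where "cs = map (row S) (sorted_list_of_set D) @ map (unit_vec n) (sorted_list_of_set E)"
  have "card {i. i < n \<and> e i > 0} + card E = card ({i. i < n \<and> e i > 0} \<union> E)"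
    using fin by (intro card_Un_disjoint[symmetric]) (auto simp: E_def)
  also have "{i. i < n \<and> e i > 0} \<union> E = {..<n}" by (auto simp: E_def)
  finally have "length cs < n" using less by (simp add: cs_def D_def)
  moreover have set: "set cs = row S ` D \<union> unit_vec n ` E" using fin by (simp add: cs_def)
  moreover have "set cs \<subseteq> carrier_vec n" using S by (auto simp: set)
  ultimately obtain x where x: "x \<in> carrier_vec n" "x \<noteq> 0\<^sub>v n"
    and rows: "\<And>i. i \<in> D \<Longrightarrow> row S i \<bullet> x = 0" and units: "\<And>i. i \<in> E \<Longrightarrow> unit_vec n i \<bullet> x = 0"
    using underdetermined_system[of cs n] by (metis UnI1 UnI2 imageI)
  have Sx: "(S *\<^sub>v x) $ i = 0" if "i < n" "d i > 0" for i
    using rows[of i] S that by (simp add: D_def)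
  have xE: "x $ i = 0" if "i < n" "\<not> e i > 0" for i
    using units[of i] x that by (simp add: E_def)
  obtain k where k: "k < n" "x $ k \<noteq> 0"
    using x by (metis eq_vecI carrier_vecD index_zero_vec)
  have "(\<Sum>i<n. d i * (cmod ((S *\<^sub>v x) $ i))\<^sup>2) \<le> 0"
  proof (rule sum_nonpos)
    fix i assume "i \<in> {..<n}"
    then show "d i * (cmod ((S *\<^sub>v x) $ i))\<^sup>2 \<le> 0"
      using Sx[of i] by (cases "d i > 0") (auto simp: mult_nonpos_nonneg)
  qed
  \<comment> \<open>A nonzero coordinate of \<open>x\<close> lies outside \<open>E\<close>, so its
    coefficient is positive and makes the sum strictly positive.\<close>
  moreover have "(\<Sum>i<n. e i * (cmod (x $ i))\<^sup>2) > 0"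
  proof (rule sum_pos2[of _ k])
    show "e k * (cmod (x $ k))\<^sup>2 > 0" using k xE by (metis mult_pos_pos zero_less_norm_iff zero_less_power)
    show "e i * (cmod (x $ i))\<^sup>2 \<ge> 0" if "i \<in> {..<n}" for i
      using xE[of i] that by (cases "e i > 0") auto
  qed (use k in auto)
  ultimately show False using form[OF x(1)] by simp
qed

lemma Re_sesq_mat_diag:
  fixes d :: "nat \<Rightarrow> real"
  assumes "x \<in> carrier_vec n"
  shows "Re (sesq (mat_diag n (\<lambda>i. complex_of_real (d i))) x x) = (\<Sum>i<n. d i * (cmod (x $ i))\<^sup>2)"
proof -
  have "complex_of_real r * z * cnj z = complex_of_real (r * (cmod z)\<^sup>2)" for r z
    by (simp only: of_real_mult complex_norm_square mult.assoc)
  then show ?thesis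
    using assms by (simp add: sesq_mat_diag del: of_real_mult of_real_power)
qed

lemma det_congruence:
  fixes S M :: "complex mat"
  assumes "S \<in> carrier_mat n n" "M \<in> carrier_mat n n"
  shows "det (mat_adjoint S * M * S) = complex_of_real ((cmod (det S))\<^sup>2) * det M"
proof -
  have "mat_adjoint S * M \<in> carrier_mat n n"
    using assms by (intro mult_carrier_mat[of _ n n]) auto
  then have "det (mat_adjoint S * M * S) = det (mat_adjoint S * M) * det S"
    using assms by (intro det_mult[of _ n]) auto
  also have "det (mat_adjoint S * M) = cnj (det S) * det M"
    using assms det_mult[of "mat_adjoint S" n M] by (simp add: det_mat_adjoint[of _ n])
  finally show ?thesis
    unfolding complex_norm_square by (simp only: mult_ac)
qed

text \<open>Comparing determinants shows that no \<open>e i\<close> vanishes.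
  \<open>inertia_le\<close>, applied to the forms and to their negatives, bounds both the positive
  and the negative count; each pair of counts sums to \<open>n\<close>, so the bounds are
  equalities.\<close>

lemma sylvester_inertia:
  fixes d e :: "nat \<Rightarrow> real"
  assumes S: "S \<in> carrier_mat n n" "det S \<noteq> 0"
    and d: "\<And>i. i < n \<Longrightarrow> d i \<noteq> 0"
    and cong: "mat_adjoint S * mat_diag n (\<lambda>i. complex_of_real (d i)) * S =
      mat_diag n (\<lambda>i. complex_of_real (e i))"
  shows "\<And>i. i < n \<Longrightarrow> e i \<noteq> 0"
    and "card {i. i < n \<and> e i > 0} = card {i. i < n \<and> d i > 0}"
proof -
  let ?D = "mat_diag n (\<lambda>i. complex_of_real (d i))" and ?E = "mat_diag n (\<lambda>i. complex_of_real (e i))"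
  have "det ?E = complex_of_real ((cmod (det S))\<^sup>2) * det ?D"
    using det_congruence[OF S(1) mat_diag_dim] unfolding cong[symmetric] .
  moreover have "det ?D \<noteq> 0" using d by (simp add: det_mat_diag)
  ultimately have "det ?E \<noteq> 0" using S(2) by simp
  then show e: "e i \<noteq> 0" if "i < n" for i using that by (auto simp: det_mat_diag)
  have form: "(\<Sum>i<n. d i * (cmod ((S *\<^sub>v x) $ i))\<^sup>2) = (\<Sum>i<n. e i * (cmod (x $ i))\<^sup>2)"
    if x: "x \<in> carrier_vec n" for x
  proof -
    have Sx: "S *\<^sub>v x \<in> carrier_vec n" using S(1) x by simp
    have "sesq ?E x x = sesq ?D (S *\<^sub>v x) (S *\<^sub>v x)"
      by (rule sesq_congruence[OF S(1) mat_diag_dim x x, of "\<lambda>i. complex_of_real (d i)", unfolded cong])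
    then have "Re (sesq ?D (S *\<^sub>v x) (S *\<^sub>v x)) = Re (sesq ?E x x)" by simp
    then show ?thesis unfolding Re_sesq_mat_diag[OF Sx] Re_sesq_mat_diag[OF x] .
  qed
  have le: "card {i. i < n \<and> e i > 0} \<le> card {i. i < n \<and> d i > 0}"
    by (rule inertia_le[OF S(1) form])
  have le': "card {i. i < n \<and> - e i > 0} \<le> card {i. i < n \<and> - d i > 0}"
  proof (rule inertia_le[OF S(1)])
    fix x :: "complex vec" assume "x \<in> carrier_vec n"
    from form[OF this] show "(\<Sum>i<n. - d i * (cmod ((S *\<^sub>v x) $ i))\<^sup>2) = (\<Sum>i<n. - e i * (cmod (x $ i))\<^sup>2)"
      by (simp only: mult_minus_left sum_negf)
  qed
  have split: "card {i. i < n \<and> f i > 0} + card {i. i < n \<and> - f i > 0} = n"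
    if nz: "\<And>i. i < n \<Longrightarrow> f i \<noteq> 0" for f :: "nat \<Rightarrow> real"
  proof -
    have "- f i > 0 \<longleftrightarrow> \<not> f i > 0" if "i < n" for i using nz[OF that] by linarith
    then have "{i. i < n \<and> - f i > 0} = {..<n} - {i. i < n \<and> f i > 0}" by blast
    moreover have "card ({..<n} - {i. i < n \<and> f i > 0}) = n - card {i. i < n \<and> f i > 0}"
      by (subst card_Diff_subset) auto
    moreover have "card {i. i < n \<and> f i > 0} \<le> card {..<n}"
      by (rule card_mono) auto
    ultimately show ?thesis by simp
  qed
  show "card {i. i < n \<and> e i > 0} = card {i. i < n \<and> d i > 0}"
    using le le' split[of d, OF d] split[of e, OF e] by linarith
qed

section \<open>The pairing, its groups, and the definiteness condition\<close>

definition signature :: "nat \<Rightarrow> nat \<Rightarrow> real" where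
  "signature p i = (if i < p then 1 else -1)"

text \<open>This is the matrix \<open>J\<close> of the overview.\<close>

definition sig_mat :: "nat \<Rightarrow> nat \<Rightarrow> complex mat" where
  "sig_mat p q = mat_diag (p + q) (\<lambda>i. complex_of_real (signature p i))"

lemma sig_mat_carrier [simp]: "sig_mat p q \<in> carrier_mat (p + q) (p + q)"
  by (simp add: sig_mat_def)

lemma mat_adjoint_sig_mat [simp]: "mat_adjoint (sig_mat p q) = sig_mat p q"
  by (rule eq_matI) (auto simp: sig_mat_def mat_diag_def)

lemma det_sig_mat_nonzero: "det (sig_mat p q) \<noteq> 0"
  by (auto simp: sig_mat_def det_mat_diag signature_def)

lemma pairing_eq_sesq:
  assumes "x \<in> carrier_vec (p + q)" "y \<in> carrier_vec (p + q)"
  shows "pairing p q x y = sesq (sig_mat p q) x y"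
proof -
  have "{..<p + q} = {..<p} \<union> {p..<p + q}" by auto
  then have "sesq (sig_mat p q) x y =
      (\<Sum>i<p. complex_of_real (signature p i) * x $ i * cnj (y $ i)) +
      (\<Sum>i = p..<p + q. complex_of_real (signature p i) * x $ i * cnj (y $ i))"
    using assms by (simp add: sig_mat_def sesq_mat_diag sum.union_disjoint ivl_disj_int)
  also have "(\<Sum>i<p. complex_of_real (signature p i) * x $ i * cnj (y $ i)) = (\<Sum>i<p. x $ i * cnj (y $ i))"
    by (simp add: signature_def)
  also have "(\<Sum>i = p..<p + q. complex_of_real (signature p i) * x $ i * cnj (y $ i)) =
      - (\<Sum>i = p..<p + q. x $ i * cnj (y $ i))"
    by (simp add: signature_def sum_negf)
  finally show ?thesis by (simp add: pairing_def)
qed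

text \<open>By \<open>eq_mat_sesqI\<close>, invariance of the pairing is one matrix equation. The
  final construction establishes membership in this form.\<close>

lemma SU_iff:
  "g \<in> SU p q \<longleftrightarrow> g \<in> SL (p + q) \<and> mat_adjoint g * sig_mat p q * g = sig_mat p q"
proof (cases "g \<in> SL (p + q)")
  case True
  then have g: "g \<in> carrier_mat (p + q) (p + q)" by (simp add: SL_def)
  have "sesq (mat_adjoint g * sig_mat p q * g) x y = pairing p q (g *\<^sub>v x) (g *\<^sub>v y)"
    if "x \<in> carrier_vec (p + q)" "y \<in> carrier_vec (p + q)" for x y
    using that g by (simp add: sesq_congruence[of _ "p + q" "p + q"] pairing_eq_sesq)
  then show ?thesis
    using True g by (auto simp: SU_def pairing_eq_sesq intro!: eq_mat_sesqI[of _ "p + q"])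
qed (simp add: SU_def)

lemma SL_inverse:
  assumes "A \<in> SL n"
  obtains B where "B \<in> SL n" "A * B = 1\<^sub>m n" "B * A = 1\<^sub>m n"
proof -
  have A: "A \<in> carrier_mat n n" "det A = 1" using assms by (auto simp: SL_def)
  have one: "1 \<cdot>\<^sub>m 1\<^sub>m n = (1\<^sub>m n :: complex mat)" by (rule eq_matI) auto
  have B: "adj_mat A \<in> carrier_mat n n" "A * adj_mat A = 1\<^sub>m n" "adj_mat A * A = 1\<^sub>m n"
    using adj_mat[OF A(1)] one by (simp_all add: A(2))
  have "det A * det (adj_mat A) = 1"
    using det_mult[OF A(1) B(1)] B(2) by simp
  with A B that[of "adj_mat A"] show ?thesis by (simp add: SL_def)
qed

lemma SL_mult: "A \<in> SL n \<Longrightarrow> B \<in> SL n \<Longrightarrow> A * B \<in> SL n"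
  by (auto simp: SL_def det_mult intro: mult_carrier_mat)

lemma SL_mult_vec_nonzero:
  assumes "A \<in> SL n" "x \<in> carrier_vec n" "x \<noteq> 0\<^sub>v n"
  shows "A *\<^sub>v x \<noteq> 0\<^sub>v n"
  using assms det_0_iff_vec_prod_zero[of A n] by (auto simp: SL_def)

text \<open>A term of entry \<open>(i, j)\<close> survives only if \<open>i \<le> k \<le> j\<close>.
  On the diagonal only \<open>k = i\<close> remains, so diagonal entries multiply and stay
  positive.\<close>

lemma AN_group_mult:
  assumes A: "A \<in> AN_group n" and B: "B \<in> AN_group n"
  shows "A * B \<in> AN_group n"
proof -
  have c: "A \<in> carrier_mat n n" "B \<in> carrier_mat n n" using A B by (auto simp: AN_group_def SL_def)
  have ut: "A $$ (i, j) = 0" "B $$ (i, j) = 0" if "j < i" "i < n" for i j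
    using A B c that by (auto simp: AN_group_def upper_triangular_def)
  have e: "(A * B) $$ (i, j) = (\<Sum>k<n. A $$ (i, k) * B $$ (k, j))" if "i < n" "j < n" for i j
    using c that by (simp add: scalar_prod_def atLeast0LessThan)
  have "(A * B) $$ (i, j) = 0" if "j < i" "i < n" for i j
  proof -
    have "A $$ (i, k) * B $$ (k, j) = 0" if "k < n" for k
      using ut[of k i] ut[of j k] \<open>j < i\<close> \<open>i < n\<close> that by (cases "k < i") auto
    then show ?thesis using that by (subst e) (auto intro!: sum.neutral)
  qed
  then have "upper_triangular (A * B)" using c by (auto simp: upper_triangular_def)
  moreover have "(A * B) $$ (i, i) \<in> \<real> \<and> 0 < Re ((A * B) $$ (i, i))" if i: "i < n" for i
  proof -
    have "A $$ (i, k) * B $$ (k, i) = 0" if "k < n" "k \<noteq> i" for k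
      using ut[of k i] ut[of i k] i that by (cases "k < i") auto
    then have "(A * B) $$ (i, i) = (\<Sum>k<n. if k = i then A $$ (i, k) * B $$ (k, i) else 0)"
      unfolding e[OF i i] by (intro sum.cong) auto
    then have "(A * B) $$ (i, i) = A $$ (i, i) * B $$ (i, i)" using i by simp
    moreover have "A $$ (i, i) \<in> \<real>" "0 < Re (A $$ (i, i))" "B $$ (i, i) \<in> \<real>" "0 < Re (B $$ (i, i))"
      using A B c i by (auto simp: AN_group_def pos_real_diag_def)
    ultimately show ?thesis by (auto elim!: Reals_cases)
  qed
  then have "pos_real_diag (A * B)" using c by (simp add: pos_real_diag_def)
  ultimately show ?thesis using A B by (simp add: AN_group_def SL_mult)
qed

text \<open>Positive definiteness of \<open>mat_adjoint b * J * b - l J\<close>, phrased through the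
  pairing so that it can be chained. The pairing of a vector with itself is real, hence
  \<open>Re\<close> loses nothing.\<close>

definition dominates :: "nat \<Rightarrow> nat \<Rightarrow> real \<Rightarrow> complex mat \<Rightarrow> bool" where
  "dominates p q l b \<longleftrightarrow> (\<forall>x \<in> carrier_vec (p + q). x \<noteq> 0\<^sub>v (p + q) \<longrightarrow>
     l * Re (pairing p q x x) < Re (pairing p q (b *\<^sub>v x) (b *\<^sub>v x)))"

text \<open>The inequality for \<open>b2\<close> at \<open>x\<close> is multiplied by
  \<open>l > 0\<close> and followed by the one for \<open>b1\<close> at
  \<open>b2 *\<^sub>v x\<close>, a nonzero vector because \<open>b2\<close> is invertible.\<close>

lemma dominates_mult:
  assumes b1: "dominates p q l b1" "b1 \<in> SL (p + q)" and b2: "dominates p q m b2" "b2 \<in> SL (p + q)"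
    and l: "l > 0"
  shows "dominates p q (l * m) (b1 * b2)"
  unfolding dominates_def
proof (intro ballI impI)
  fix x :: "complex vec" assume x: "x \<in> carrier_vec (p + q)" "x \<noteq> 0\<^sub>v (p + q)"
  have c: "b1 \<in> carrier_mat (p + q) (p + q)" "b2 \<in> carrier_mat (p + q) (p + q)"
    using b1 b2 by (auto simp: SL_def)
  have "l * m * Re (pairing p q x x) < l * Re (pairing p q (b2 *\<^sub>v x) (b2 *\<^sub>v x))"
    using b2(1) x l by (simp add: dominates_def mult.assoc)
  also have "\<dots> < Re (pairing p q (b1 *\<^sub>v (b2 *\<^sub>v x)) (b1 *\<^sub>v (b2 *\<^sub>v x)))"
    using b1(1) x c SL_mult_vec_nonzero[OF b2(2) x] by (simp add: dominates_def)
  finally show "l * m * Re (pairing p q x x) < Re (pairing p q (b1 * b2 *\<^sub>v x) (b1 * b2 *\<^sub>v x))"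
    using x c by (simp add: assoc_mult_mat_vec[of _ "p + q" "p + q" _ "p + q"])
qed

section \<open>Admissible elements satisfy the definiteness condition\<close>

lemma Re_pairing:
  assumes "x \<in> carrier_vec (p + q)"
  shows "Re (pairing p q x x) = (\<Sum>i<p + q. signature p i * (cmod (x $ i))\<^sup>2)"
  using assms by (simp add: pairing_eq_sesq sig_mat_def Re_sesq_mat_diag)

text \<open>A number \<open>m\<close> strictly between the two groups of diagonal entries gives
  \<open>l = m\<^sup>2\<close>: the desired inequality then holds coordinate by coordinate.\<close>

lemma A_adm_dominates:
  assumes p: "p \<ge> 1" and q: "q \<ge> 1" and a: "a \<in> A_adm p q"
  obtains l where "l > 0" "dominates p q l a"
proof -
  define r where "r i = Re (a $$ (i, i))" for i
  have ac: "a \<in> carrier_mat (p + q) (p + q)" "diagonal_mat a"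
    using a by (auto simp: A_adm_def A_group_def SL_def)
  have r: "r i > 0" "a $$ (i, i) = complex_of_real (r i)" if "i < p + q" for i
    using a ac that by (auto simp: A_adm_def A_group_def pos_real_diag_def r_def of_real_Re)
  have adm: "r j < r i" if "i < p" "p \<le> j" "j < p + q" for i j
    using a that by (auto simp: A_adm_def r_def)
  \<comment> \<open>Both blocks are nonempty since \<open>p\<close> and \<open>q\<close> are at
    least 1, so the extrema are attained and admissibility separates them.\<close>
  define lo hi where "lo = Max (r ` {p..<p + q})" and "hi = Min (r ` {..<p})"
  have lo: "r j \<le> lo" if "p \<le> j" "j < p + q" for j
    using that by (auto simp: lo_def intro!: Max_ge)
  have hi: "hi \<le> r i" if "i < p" for i
    using that by (auto simp: hi_def intro!: Min_le)
  have "lo \<in> r ` {p..<p + q}" "hi \<in> r ` {..<p}"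
    unfolding lo_def hi_def using p q by (auto intro!: Max_in Min_in simp: lessThan_empty_iff)
  then have "lo < hi" "lo > 0" using adm r by auto
  define m where "m = (lo + hi) / 2"
  have m: "lo < m" "m < hi" "m > 0" using \<open>lo < hi\<close> \<open>lo > 0\<close> by (auto simp: m_def)
  have a_eq: "a = mat_diag (p + q) (\<lambda>i. complex_of_real (r i))"
    using ac r by (intro eq_matI) (auto simp: mat_diag_def diagonal_mat_def)
  have ax: "(a *\<^sub>v x) $ i = complex_of_real (r i) * x $ i" if "i < p + q" "x \<in> carrier_vec (p + q)" for i x
  proof -
    have "(a *\<^sub>v x) $ i = (\<Sum>j<p + q. a $$ (i, j) * x $ j)"
      using that ac by (simp add: scalar_prod_def atLeast0LessThan)
    also have "\<dots> = (\<Sum>j<p + q. if j = i then complex_of_real (r j) * x $ j else 0)"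
      using that by (intro sum.cong) (auto simp: a_eq mat_diag_def)
    finally show ?thesis using that by simp
  qed
  \<comment> \<open>In the second block the entries are smaller than \<open>m\<close>, and the sign
    -1 reverses the comparison, so one inequality serves both blocks.\<close>
  have strict: "m\<^sup>2 * signature p i < signature p i * (r i)\<^sup>2" if i: "i < p + q" for i
  proof (cases "i < p")
    case True
    then have "m < r i" using hi[of i] m by simp
    then show ?thesis using True m by (simp add: signature_def power_strict_mono)
  next
    case False
    then have "r i < m" using lo[of i] m i by simp
    then show ?thesis using False r(1)[OF i] by (simp add: signature_def power_strict_mono)
  qed
  have "dominates p q (m\<^sup>2) a"
    unfolding dominates_def
  proof (intro ballI impI)
    fix x :: "complex vec" assume x: "x \<in> carrier_vec (p + q)" "x \<noteq> 0\<^sub>v (p + q)"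
    obtain k where k: "k < p + q" "x $ k \<noteq> 0"
      using x by (metis eq_vecI carrier_vecD index_zero_vec)
    have "m\<^sup>2 * Re (pairing p q x x) = (\<Sum>i<p + q. m\<^sup>2 * signature p i * (cmod (x $ i))\<^sup>2)"
      using x by (simp add: Re_pairing sum_distrib_left mult.assoc)
    also have "\<dots> < (\<Sum>i<p + q. signature p i * (r i)\<^sup>2 * (cmod (x $ i))\<^sup>2)"
    proof (rule sum_strict_mono_ex1)
      show "\<forall>i\<in>{..<p + q}. m\<^sup>2 * signature p i * (cmod (x $ i))\<^sup>2 \<le> signature p i * (r i)\<^sup>2 * (cmod (x $ i))\<^sup>2"
        using strict by (auto intro!: mult_right_mono intro: less_imp_le)
      show "\<exists>i\<in>{..<p + q}. m\<^sup>2 * signature p i * (cmod (x $ i))\<^sup>2 < signature p i * (r i)\<^sup>2 * (cmod (x $ i))\<^sup>2"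
        using mult_strict_right_mono[OF strict[OF k(1)], of "(cmod (x $ k))\<^sup>2"] k by auto
    qed simp
    also have "\<dots> = (\<Sum>i<p + q. signature p i * (cmod ((a *\<^sub>v x) $ i))\<^sup>2)"
      using x by (intro sum.cong) (auto simp: ax norm_mult power_mult_distrib)
    also have "\<dots> = Re (pairing p q (a *\<^sub>v x) (a *\<^sub>v x))"
      using x ac by (simp add: Re_pairing)
    finally show "m\<^sup>2 * Re (pairing p q x x) < Re (pairing p q (a *\<^sub>v x) (a *\<^sub>v x))" .
  qed
  with m that[of "m\<^sup>2"] show ?thesis by simp
qed

text \<open>Since \<open>g\<close> and \<open>g'\<close> preserve the pairing and
  \<open>a * g = g' * b\<close>, the inequality for \<open>a\<close> at \<open>g *\<^sub>v x\<close>
  is the inequality for \<open>b\<close> at \<open>x\<close>, with the same constant.\<close>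

lemma AN_adm_dominates:
  assumes "p \<ge> 1" "q \<ge> 1" and b: "b \<in> AN_adm p q"
  obtains l where "l > 0" "dominates p q l b"
proof -
  obtain a g g' where a: "a \<in> A_adm p q" and g: "g \<in> SU p q" and g': "g' \<in> SU p q"
    and eq: "a * g = g' * b" and bAN: "b \<in> AN_group (p + q)"
    using b by (auto simp: AN_adm_def dressing_def)
  obtain l where l: "l > 0" "dominates p q l a"
    using A_adm_dominates[OF assms(1,2) a] .
  have c: "a \<in> carrier_mat (p + q) (p + q)" "g \<in> carrier_mat (p + q) (p + q)"
      "g' \<in> carrier_mat (p + q) (p + q)" "b \<in> carrier_mat (p + q) (p + q)"
    using a g g' bAN by (auto simp: A_adm_def A_group_def AN_group_def SU_def SL_def)
  have "dominates p q l b"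
    unfolding dominates_def
  proof (intro ballI impI)
    fix x :: "complex vec" assume x: "x \<in> carrier_vec (p + q)" "x \<noteq> 0\<^sub>v (p + q)"
    have "l * Re (pairing p q x x) = l * Re (pairing p q (g *\<^sub>v x) (g *\<^sub>v x))"
      using g x by (simp add: SU_def)
    also have "\<dots> < Re (pairing p q (a *\<^sub>v (g *\<^sub>v x)) (a *\<^sub>v (g *\<^sub>v x)))"
      using l(2) x c SL_mult_vec_nonzero[of g "p + q" x] g
      by (metis (no_types, lifting) dominates_def SU_iff mult_mat_vec_carrier)
    also have "a *\<^sub>v (g *\<^sub>v x) = g' *\<^sub>v (b *\<^sub>v x)"
      using assoc_mult_mat_vec[OF c(1,2) x(1)] assoc_mult_mat_vec[OF c(3,4) x(1)] eq by simp
    also have "pairing p q (g' *\<^sub>v (b *\<^sub>v x)) (g' *\<^sub>v (b *\<^sub>v x)) = pairing p q (b *\<^sub>v x) (b *\<^sub>v x)"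
      using g' x c by (simp add: SU_def)
    finally show "l * Re (pairing p q x x) < Re (pairing p q (b *\<^sub>v x) (b *\<^sub>v x))" .
  qed
  with l that show ?thesis by blast
qed

section \<open>Elements of \<open>AN\<close> satisfying the condition are admissible\<close>

lemma congruence_smult:
  assumes T: "T \<in> carrier_mat n n" and M: "M \<in> carrier_mat n n" and c: "cmod c = 1"
  shows "mat_adjoint (c \<cdot>\<^sub>m T) * M * (c \<cdot>\<^sub>m T) = mat_adjoint T * M * T"
proof (rule eq_mat_sesqI[of _ n])
  fix x y :: "complex vec" assume xy: "x \<in> carrier_vec n" "y \<in> carrier_vec n"
  have cT: "(c \<cdot>\<^sub>m T) *\<^sub>v z = c \<cdot>\<^sub>v (T *\<^sub>v z)" if "z \<in> carrier_vec n" for z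
    using T that by (intro eq_vecI) auto
  have Txy: "T *\<^sub>v x \<in> carrier_vec n" "T *\<^sub>v y \<in> carrier_vec n"
    using T xy by simp_all
  have cTc: "c \<cdot>\<^sub>m T \<in> carrier_mat n n" using T by simp
  have "c * cnj c = 1" using c complex_norm_square[of c] by simp
  have "sesq (mat_adjoint (c \<cdot>\<^sub>m T) * M * (c \<cdot>\<^sub>m T)) x y =
      sesq M (c \<cdot>\<^sub>v (T *\<^sub>v x)) (c \<cdot>\<^sub>v (T *\<^sub>v y))"
    using sesq_congruence[OF cTc M xy] by (simp add: cT xy)
  also have "\<dots> = c * (cnj c * sesq M (T *\<^sub>v x) (T *\<^sub>v y))"
    using M Txy by (simp add: sesq_smult[of _ n])
  also have "\<dots> = sesq M (T *\<^sub>v x) (T *\<^sub>v y)"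
    using \<open>c * cnj c = 1\<close> by (simp flip: mult.assoc)
  also have "\<dots> = sesq (mat_adjoint T * M * T) x y"
    by (rule sesq_congruence[OF T M xy, symmetric])
  finally show "sesq (mat_adjoint (c \<cdot>\<^sub>m T) * M * (c \<cdot>\<^sub>m T)) x y = sesq (mat_adjoint T * M * T) x y" .
qed (use T in auto)

text \<open>Scaling an \<open>n\<close> by \<open>n\<close> matrix by \<open>c\<close> multiplies
  its determinant by the \<open>n\<close>-th power of \<open>c\<close>; this root corrects a
  determinant of modulus 1 to 1.\<close>

lemma unimodular_root:
  assumes "cmod z = 1" "n > 0"
  obtains c where "cmod c = 1" "c ^ n = z"
proof -
  have "z = cis (Arg z)" using assms(1) rcis_cmod_Arg[of z] by (simp add: rcis_def)
  moreover have "cis (Arg z / n) ^ n = cis (Arg z)" using assms(2) by (simp add: DeMoivre)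
  ultimately show ?thesis using that[of "cis (Arg z / n)"] by simp
qed

lemma sesq_minus_smult:
  assumes "H \<in> carrier_mat n n" "J \<in> carrier_mat n n" "x \<in> carrier_vec n" "y \<in> carrier_vec n"
  shows "sesq (H - c \<cdot>\<^sub>m J) x y = sesq H x y - c * sesq J x y"
proof -
  have "sesq (H - c \<cdot>\<^sub>m J) x y = (\<Sum>i<n. \<Sum>j<n. (H - c \<cdot>\<^sub>m J) $$ (i, j) * x $ j * cnj (y $ i))"
    using assms by (intro sesq_eq_sum) auto
  also have "\<dots> = (\<Sum>i<n. \<Sum>j<n. H $$ (i, j) * x $ j * cnj (y $ i) - c * (J $$ (i, j) * x $ j * cnj (y $ i)))"
    using assms by (intro sum.cong) (auto simp: algebra_simps)
  also have "\<dots> = sesq H x y - c * sesq J x y"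
    using assms by (simp add: sesq_eq_sum sum_subtractf sum_distrib_left)
  finally show ?thesis .
qed

text \<open>The dressing element is the inverse \<open>g\<close> of \<open>S\<close>, and the left
  factor is \<open>a * g * B\<close> with \<open>B\<close> the inverse of \<open>b\<close>. The
  congruence says that \<open>a\<close> and \<open>b * S\<close> pull the pairing back to the same
  form, so this left factor preserves the pairing.\<close>

lemma dressing_of_congruence:
  assumes b: "b \<in> AN_group (p + q)" and a: "a \<in> AN_group (p + q)" and S: "S \<in> SU p q"
    and eq: "mat_adjoint S * (mat_adjoint b * sig_mat p q * b) * S = mat_adjoint a * sig_mat p q * a"
  shows "\<exists>g. dressing p q a g b"
proof -
  define n where "n = p + q"
  have SL: "b \<in> SL n" "a \<in> SL n" "S \<in> SL n"
    using b a S by (auto simp: AN_group_def SU_def n_def)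
  obtain g where g: "g \<in> SL n" "S * g = 1\<^sub>m n" using SL_inverse[OF SL(3)] by metis
  obtain B where B: "B \<in> SL n" "b * B = 1\<^sub>m n" "B * b = 1\<^sub>m n" using SL_inverse[OF SL(1)] by metis
  have c: "b \<in> carrier_mat n n" "a \<in> carrier_mat n n" "S \<in> carrier_mat n n"
    "g \<in> carrier_mat n n" "B \<in> carrier_mat n n" "sig_mat p q \<in> carrier_mat n n"
    using SL g B by (auto simp: SL_def n_def)
  have inv: "S *\<^sub>v (g *\<^sub>v x) = x" "b *\<^sub>v (B *\<^sub>v x) = x" if "x \<in> carrier_vec n" for x
    using that c g(2) B(2) by (simp_all flip: assoc_mult_mat_vec[of _ n n _ n])
  have ga: "pairing p q (a *\<^sub>v x) (a *\<^sub>v y) = pairing p q (b *\<^sub>v (S *\<^sub>v x)) (b *\<^sub>v (S *\<^sub>v y))"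
    if "x \<in> carrier_vec n" "y \<in> carrier_vec n" for x y
  proof -
    have "sesq (mat_adjoint a * sig_mat p q * a) x y =
        sesq (mat_adjoint S * (mat_adjoint b * sig_mat p q * b) * S) x y"
      by (simp add: eq)
    then show ?thesis
      using that c by (simp add: sesq_congruence[of _ n n] pairing_eq_sesq n_def)
  qed
  have "g \<in> SU p q"
    unfolding SU_def
  proof (intro CollectI conjI ballI)
    fix x y :: "complex vec" assume xy: "x \<in> carrier_vec (p + q)" "y \<in> carrier_vec (p + q)"
    have "pairing p q (g *\<^sub>v x) (g *\<^sub>v y) = pairing p q (S *\<^sub>v (g *\<^sub>v x)) (S *\<^sub>v (g *\<^sub>v y))"
      using S xy c by (simp add: SU_def n_def)
    then show "pairing p q (g *\<^sub>v x) (g *\<^sub>v y) = pairing p q x y"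
      using xy by (simp add: inv n_def)
  qed (use g in \<open>simp add: n_def\<close>)
  moreover have "a * g * B \<in> SU p q"
    unfolding SU_def
  proof (intro CollectI conjI ballI)
    show "a * g * B \<in> SL (p + q)" using SL g B by (auto simp: n_def intro!: SL_mult)
    fix x y :: "complex vec" assume xy: "x \<in> carrier_vec (p + q)" "y \<in> carrier_vec (p + q)"
    have "(a * g * B) *\<^sub>v z = a *\<^sub>v (g *\<^sub>v (B *\<^sub>v z))" if "z \<in> carrier_vec n" for z
      using that c by (simp add: assoc_mult_mat_vec[of _ n n _ n] mult_carrier_mat[of _ n n _ n])
    then show "pairing p q (a * g * B *\<^sub>v x) (a * g * B *\<^sub>v y) = pairing p q x y"
      using xy c by (simp add: ga inv n_def)
  qed
  moreover have "a * g = a * g * B * b"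
  proof -
    have "a * g * B * b = a * g * (B * b)"
      using c by (intro assoc_mult_mat[of _ n n _ n _ n]) auto
    then show ?thesis using c B by (simp add: mult_carrier_mat[of _ n n _ n])
  qed
  ultimately show ?thesis using a b by (auto simp: dressing_def)
qed

text \<open>With \<open>p\<close> positive values and no zeros there are \<open>q\<close> negative
  ones, so bijections from the two index blocks onto the two sign classes can be glued
  together.\<close>

lemma reorder_by_sign:
  fixes d :: "nat \<Rightarrow> real"
  assumes nz: "\<And>i. i < p + q \<Longrightarrow> d i \<noteq> 0" and card: "card {i. i < p + q \<and> d i > 0} = p"
  obtains \<pi> where "bij_betw \<pi> {..<p + q} {..<p + q}"
    "\<And>i. i < p \<Longrightarrow> d (\<pi> i) > 0" "\<And>i. p \<le> i \<Longrightarrow> i < p + q \<Longrightarrow> d (\<pi> i) < 0"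
proof -
  define P N where "P = {i. i < p + q \<and> d i > 0}" and "N = {i. i < p + q \<and> d i < 0}"
  have fin: "finite P" "finite N" by (auto simp: P_def N_def)
  have un: "P \<union> N = {..<p + q}" "P \<inter> N = {}"
    using nz by (fastforce simp: P_def N_def neq_iff)+
  have "card P = p" using card by (simp add: P_def)
  moreover from this have "card N = q"
    using card_Un_disjoint[OF fin un(2)] un(1) by simp
  ultimately obtain f g where f: "bij_betw f {..<p} P" and g: "bij_betw g {p..<p + q} N"
    using fin by (metis finite_same_card_bij card_lessThan card_atLeastLessThan finite_lessThan
        finite_atLeastLessThan add_diff_cancel_left')
  define \<pi> where "\<pi> i = (if i \<in> {..<p} then f i else g i)" for i
  have "bij_betw \<pi> ({..<p} \<union> {p..<p + q}) (P \<union> N)"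
    unfolding \<pi>_def by (rule bij_betw_disjoint_Un[OF f g _ un(2)]) auto
  moreover have "{..<p} \<union> {p..<p + q} = {..<p + q}" by auto
  moreover have "d (\<pi> i) > 0" if "i < p" for i
    using bij_betw_apply[OF f, of i] that by (simp add: \<pi>_def P_def)
  moreover have "d (\<pi> i) < 0" if "p \<le> i" "i < p + q" for i
    using bij_betw_apply[OF g, of i] that by (simp add: \<pi>_def N_def)
  ultimately show ?thesis using that un(1) by metis
qed

text \<open>The columns of \<open>T\<close> are rescaled permuted columns of \<open>S\<close>, so
  the Gram matrix is permuted and rescaled accordingly. \<open>M\<close> is arbitrary because the
  same \<pi> and \<open>r\<close> are applied to two forms.\<close>

lemma congruence_permute_scale:
  fixes e r :: "nat \<Rightarrow> real"
  assumes S: "S \<in> carrier_mat n n" and M: "M \<in> carrier_mat n n"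
    and diag: "mat_adjoint S * M * S = mat_diag n (\<lambda>i. complex_of_real (e i))"
    and \<pi>: "bij_betw \<pi> {..<n} {..<n}"
  defines "T \<equiv> mat n n (\<lambda>(i, j). complex_of_real (r j) * S $$ (i, \<pi> j))"
  shows "mat_adjoint T * M * T = mat_diag n (\<lambda>i. complex_of_real ((r i)\<^sup>2 * e (\<pi> i)))"
proof (rule eq_matI)
  have T: "T \<in> carrier_mat n n" by (simp add: T_def)
  fix i j assume "i < dim_row (mat_diag n (\<lambda>i. complex_of_real ((r i)\<^sup>2 * e (\<pi> i))))"
    "j < dim_col (mat_diag n (\<lambda>i. complex_of_real ((r i)\<^sup>2 * e (\<pi> i))))"
  then have ij: "i < n" "j < n" by (simp_all add: mat_diag_def)
  have \<pi>n: "\<pi> k < n" if "k < n" for k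
    using bij_betw_apply[OF \<pi>, of k] that by simp
  have inj: "\<pi> i = \<pi> j \<longleftrightarrow> i = j"
    using ij \<pi> by (auto simp: bij_betw_def dest: inj_onD)
  have col: "col T k = complex_of_real (r k) \<cdot>\<^sub>v col S (\<pi> k)" if "k < n" for k
    using that S \<pi>n[OF that] by (intro eq_vecI) (auto simp: T_def)
  have colS: "col S k \<in> carrier_vec n" for k
    using S by (metis carrier_matD(1) col_dim)
  have "(mat_adjoint T * M * T) $$ (i, j) =
      complex_of_real (r i) * complex_of_real (r j) * sesq M (col S (\<pi> j)) (col S (\<pi> i))"
    using sesq_mat_of_cols[OF T M ij] ij M colS by (simp add: col sesq_smult[of _ n] mult_ac)
  also have "sesq M (col S (\<pi> j)) (col S (\<pi> i)) = mat_diag n (\<lambda>i. complex_of_real (e i)) $$ (\<pi> i, \<pi> j)"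
    using sesq_mat_of_cols[OF S M \<pi>n[OF ij(1)] \<pi>n[OF ij(2)]] by (simp add: diag)
  finally show "(mat_adjoint T * M * T) $$ (i, j) =
      mat_diag n (\<lambda>i. complex_of_real ((r i)\<^sup>2 * e (\<pi> i))) $$ (i, j)"
    using ij \<pi>n inj by (auto simp: mat_diag_def power2_eq_square)
qed (auto simp: T_def mat_diag_def)

lemma mat_diag_cong:
  "(\<And>i. i < n \<Longrightarrow> f i = g i) \<Longrightarrow> mat_diag n f = mat_diag n g"
  by (rule eq_matI) (auto simp: mat_diag_def)

lemma card_signature_pos: "card {i. i < p + q \<and> signature p i > 0} = p"
proof -
  have "{i. i < p + q \<and> signature p i > 0} = {..<p}" by (auto simp: signature_def split: if_splits)
  then show ?thesis by simp
qed

text \<open>Diagonalizing the definite form \<open>P = H - l J\<close> together with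
  \<open>J\<close> gives \<open>J\<close> the diagonal \<open>d\<close> and \<open>H\<close> the
  diagonal \<open>1 + l * d\<close>. The quotients \<open>l + 1 / d\<close> become the squares of
  the entries of \<open>a\<close>.\<close>

lemma dominates_imp_AN_adm:
  assumes p: "p \<ge> 1" and b: "b \<in> AN_group (p + q)" and l: "l > 0" "dominates p q l b"
  shows "b \<in> AN_adm p q"
proof -
  define n where "n = p + q"
  define J where "J = sig_mat p q"
  have n: "n > 0" using p by (simp add: n_def)
  have J: "J \<in> carrier_mat n n" "mat_adjoint J = J"
    "J = mat_diag n (\<lambda>i. complex_of_real (signature p i))"
    by (simp_all add: J_def n_def) (simp add: sig_mat_def)
  have pJ: "pairing p q x y = sesq J x y" if "x \<in> carrier_vec n" "y \<in> carrier_vec n" for x y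
    using that by (simp add: pairing_eq_sesq J_def n_def)
  have bc: "b \<in> carrier_mat n n" "det b = 1" using b by (auto simp: AN_group_def SL_def n_def)
  define H where "H = mat_adjoint b * J * b"
  have H: "H \<in> carrier_mat n n" "mat_adjoint H = H"
    using bc J mat_adjoint_congruence_eq_self[OF bc(1) J(1,2)] by (simp_all add: H_def)
  have herm: "cnj (M $$ (j, i)) = M $$ (i, j)"
    if "M \<in> carrier_mat n n" "mat_adjoint M = M" "i < n" "j < n" for M :: "complex mat" and i j
    using that mat_adjoint_index[of i M j] by simp
  define P where "P = H - complex_of_real l \<cdot>\<^sub>m J"
  have Pc: "P \<in> carrier_mat n n"
    unfolding P_def using J(1) by (intro minus_carrier_mat) simp
  have PHJ: "sesq P x y = sesq H x y - complex_of_real l * sesq J x y"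
    if "x \<in> carrier_vec n" "y \<in> carrier_vec n" for x y
    unfolding P_def by (rule sesq_minus_smult[OF H(1) J(1) that])
  have "pos_def n P"
    unfolding pos_def_def
  proof (intro conjI ballI impI)
    show "P \<in> carrier_mat n n" by (rule Pc)
    show "mat_adjoint P = P"
      using H(1) J(1) by (intro eq_matI) (auto simp: P_def herm H J(2))
    fix x :: "complex vec" assume x: "x \<in> carrier_vec n" "x \<noteq> 0\<^sub>v n"
    have "sesq H x x = pairing p q (b *\<^sub>v x) (b *\<^sub>v x)"
      using x bc J by (simp add: H_def sesq_congruence[of _ n n] pJ)
    then show "Re (sesq P x x) > 0"
      using l(2) x by (simp add: PHJ dominates_def n_def pJ[unfolded n_def])
  qed
  from simultaneous_diagonalization[OF this J(1,2)] obtain S d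
    where S: "S \<in> carrier_mat n n" "mat_adjoint S * P * S = 1\<^sub>m n"
      "mat_adjoint S * J * S = mat_diag n (\<lambda>i. complex_of_real (d i))" by blast
  have SHS: "mat_adjoint S * H * S = mat_diag n (\<lambda>i. complex_of_real (1 + l * d i))"
  proof (rule eq_mat_sesqI[of _ n])
    fix x y :: "complex vec" assume xy: "x \<in> carrier_vec n" "y \<in> carrier_vec n"
    have "sesq (mat_adjoint S * H * S) x y =
        sesq (mat_adjoint S * P * S) x y + complex_of_real l * sesq (mat_adjoint S * J * S) x y"
      using xy S(1) H(1) J(1) Pc by (simp add: sesq_congruence[of _ n n] PHJ)
    also have "\<dots> = sesq (mat_diag n (\<lambda>i. 1)) x y +
        complex_of_real l * sesq (mat_diag n (\<lambda>i. complex_of_real (d i))) x y"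
      by (simp add: S)
    also have "\<dots> = sesq (mat_diag n (\<lambda>i. complex_of_real (1 + l * d i))) x y"
      using xy by (simp add: sesq_mat_diag sum_distrib_left algebra_simps sum.distrib del: mat_diag_one)
    finally show "sesq (mat_adjoint S * H * S) x y = sesq (mat_diag n (\<lambda>i. complex_of_real (1 + l * d i))) x y" .
  qed (use S in auto)
  have detS: "det S \<noteq> 0"
    using det_congruence[OF S(1) Pc] by (auto simp: S)
  have bS: "b * S \<in> carrier_mat n n" using bc S by simp
  \<comment> \<open>Diagonalized \<open>H\<close> is itself congruent to \<open>J\<close>, through
    \<open>b * S\<close>. The law of inertia therefore also applies to
    \<open>1 + l * d\<close>.\<close>
  have "mat_adjoint (b * S) * J * (b * S) = mat_adjoint S * H * S"
  proof (rule eq_mat_sesqI[OF congruence_carrier[OF bS] congruence_carrier[OF S(1)]])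
    fix x y :: "complex vec" assume xy: "x \<in> carrier_vec n" "y \<in> carrier_vec n"
    show "sesq (mat_adjoint (b * S) * J * (b * S)) x y = sesq (mat_adjoint S * H * S) x y"
      using sesq_congruence[OF bS J(1) xy] sesq_congruence[OF S(1) H(1) xy] xy S(1) bc(1) J(1)
      by (simp add: H_def sesq_congruence[of b n n] assoc_mult_mat_vec[of b n n S n])
  qed
  then have bSJ: "mat_adjoint (b * S) * mat_diag n (\<lambda>i. complex_of_real (signature p i)) * (b * S) =
      mat_diag n (\<lambda>i. complex_of_real (1 + l * d i))"
    using SHS J(3) by simp
  have sig: "signature p i \<noteq> 0" for i by (simp add: signature_def)
  have detbS: "det (b * S) \<noteq> 0" using detS bc S by (simp add: det_mult[of _ n])
  note inert1 = sylvester_inertia[OF S(1) detS sig S(3)[unfolded J(3)]]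
  note inert2 = sylvester_inertia[OF bS detbS sig bSJ]
  define PS where "PS = {i. i < n \<and> d i > 0}"
  have cardPS: "card PS = p" using inert1(2) card_signature_pos by (simp add: n_def PS_def)
  \<comment> \<open>Where \<open>d\<close> is positive, so is \<open>1 + l * d\<close>. Both have
    exactly \<open>p\<close> positive values, so they are positive at the same places; being
    nonzero, they are also negative at the same places.\<close>
  have "PS = {i. i < n \<and> 1 + l * d i > 0}"
  proof (rule card_subset_eq)
    show "PS \<subseteq> {i. i < n \<and> 1 + l * d i > 0}"
      using l(1) by (auto simp: PS_def intro!: add_pos_pos mult_pos_pos)
    show "card PS = card {i. i < n \<and> 1 + l * d i > 0}"
      using cardPS inert2(2) card_signature_pos by (simp add: n_def)
  qed simp
  then have "i \<in> PS \<longleftrightarrow> i < n \<and> 1 + l * d i > 0" for i by auto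
  then have neg: "1 + l * d i < 0" if "i < n" "d i < 0" for i
    using inert2(1)[OF that(1)] that unfolding PS_def mem_Collect_eq by (metis linorder_neqE not_less_iff_gr_or_eq)
  obtain \<pi> where \<pi>: "bij_betw \<pi> {..<n} {..<n}"
    and pos\<pi>: "\<And>i. i < p \<Longrightarrow> d (\<pi> i) > 0" and neg\<pi>: "\<And>i. p \<le> i \<Longrightarrow> i < n \<Longrightarrow> d (\<pi> i) < 0"
    using reorder_by_sign[of p q d] inert1(1) cardPS unfolding n_def PS_def by metis
  have \<pi>n: "\<pi> i < n" if "i < n" for i using bij_betw_apply[OF \<pi>, of i] that by simp
  \<comment> \<open>This scaling turns the permuted diagonal \<open>d\<close> of \<open>J\<close>
    into the entries 1 and -1 of the signature.\<close>
  define r where "r i = 1 / sqrt \<bar>d (\<pi> i)\<bar>" for i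
  have r2: "(r i)\<^sup>2 = 1 / \<bar>d (\<pi> i)\<bar>" for i by (simp add: r_def power_divide)
  define T where "T = mat n n (\<lambda>(i, j). complex_of_real (r j) * S $$ (i, \<pi> j))"
  have T: "T \<in> carrier_mat n n" by (simp add: T_def)
  define \<alpha> where "\<alpha> i = sqrt (l + 1 / d (\<pi> i))" for i
  have quot: "l + 1 / d (\<pi> i) > 0" "(r i)\<^sup>2 * d (\<pi> i) = signature p i"
      "(r i)\<^sup>2 * (1 + l * d (\<pi> i)) = signature p i * (l + 1 / d (\<pi> i))" if i: "i < n" for i
  proof -
    have "l + 1 / d (\<pi> i) > 0 \<and> (r i)\<^sup>2 * d (\<pi> i) = signature p i \<and>
        (r i)\<^sup>2 * (1 + l * d (\<pi> i)) = signature p i * (l + 1 / d (\<pi> i))"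
    proof (cases "i < p")
      case True
      then have d: "d (\<pi> i) > 0" by (rule pos\<pi>)
      then have "l + 1 / d (\<pi> i) > 0" using l(1) by (simp add: add_pos_pos)
      then show ?thesis using d True by (simp add: r2 signature_def field_simps)
    next
      case False
      then have d: "d (\<pi> i) < 0" using neg\<pi> i by simp
      \<comment> \<open>Here \<open>1 / d\<close> is negative, so positivity of
        \<open>l + 1 / d\<close> comes from writing it as a quotient of two negative
        numbers.\<close>
      have "(1 + l * d (\<pi> i)) / d (\<pi> i) > 0"
        using neg[OF \<pi>n[OF i] d] d by (rule divide_neg_neg)
      then have "l + 1 / d (\<pi> i) > 0" using d by (simp add: add_divide_distrib add.commute)
      then show ?thesis using d False by (simp add: r2 signature_def field_simps)
    qed
    then show "l + 1 / d (\<pi> i) > 0" "(r i)\<^sup>2 * d (\<pi> i) = signature p i"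
      "(r i)\<^sup>2 * (1 + l * d (\<pi> i)) = signature p i * (l + 1 / d (\<pi> i))" by simp_all
  qed
  have \<alpha>: "\<alpha> i > 0" "(\<alpha> i)\<^sup>2 = l + 1 / d (\<pi> i)" if "i < n" for i
    using quot(1)[OF that] by (simp_all add: \<alpha>_def)
  define a where "a = mat_diag n (\<lambda>i. complex_of_real (\<alpha> i))"
  have a: "a \<in> carrier_mat n n" by (simp add: a_def)
  have TJT: "mat_adjoint T * J * T = J"
    unfolding congruence_permute_scale[OF S(1) J(1) S(3) \<pi>, of r, folded T_def]
    unfolding J(3) by (rule mat_diag_cong) (simp add: quot)
  have "mat_adjoint a = a"
    by (rule eq_matI) (auto simp: a_def mat_diag_def)
  then have "mat_adjoint a * J * a = mat_diag n (\<lambda>i. complex_of_real (\<alpha> i * signature p i * \<alpha> i))"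
    by (simp add: a_def J(3))
  also have "\<dots> = mat_diag n (\<lambda>i. complex_of_real ((r i)\<^sup>2 * (1 + l * d (\<pi> i))))"
  proof (rule mat_diag_cong)
    fix i assume i: "i < n"
    have "\<alpha> i * signature p i * \<alpha> i = signature p i * (\<alpha> i)\<^sup>2"
      by (simp add: power2_eq_square)
    then show "complex_of_real (\<alpha> i * signature p i * \<alpha> i) = complex_of_real ((r i)\<^sup>2 * (1 + l * d (\<pi> i)))"
      by (simp only: quot(3)[OF i] \<alpha>(2)[OF i])
  qed
  also have "\<dots> = mat_adjoint T * H * T"
    by (rule congruence_permute_scale[OF S(1) H(1) SHS \<pi>, of r, folded T_def, symmetric])
  finally have THT: "mat_adjoint T * H * T = mat_adjoint a * J * a" by simp
  have detJ: "det J \<noteq> 0" by (simp add: J_def det_sig_mat_nonzero)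
  have norm_det: "cmod (det M) = 1" if "complex_of_real ((cmod (det M))\<^sup>2) * det J = det J" for M
  proof -
    have "complex_of_real ((cmod (det M))\<^sup>2) = 1" using that detJ by simp
    then have "(cmod (det M))\<^sup>2 = 1" by (simp only: of_real_eq_1_iff)
    then show ?thesis using power2_eq_imp_eq[of "cmod (det M)" 1] by simp
  qed
  have detT: "cmod (det T) = 1"
    using norm_det[of T] det_congruence[OF T J(1)] TJT by simp
  \<comment> \<open>Taking determinants in \<open>THT\<close>, with \<open>det b = 1\<close> and
    \<open>det T\<close> of modulus 1, gives \<open>det a\<close> modulus 1. Its diagonal entries
    are positive, so \<open>det a = 1\<close> follows.\<close>
  have "cmod (det a) = 1"
    using norm_det[of a] det_congruence[OF a J(1)] det_congruence[OF T H(1)]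
      det_congruence[OF bc(1) J(1)] THT detT bc(2) by (simp add: H_def)
  moreover have "det a = complex_of_real (\<Prod>i<n. \<alpha> i)" by (simp add: a_def det_mat_diag)
  moreover have "(\<Prod>i<n. \<alpha> i) > 0" using \<alpha>(1) by (auto intro!: prod_pos)
  ultimately have deta: "det a = 1" by (metis abs_of_pos norm_of_real of_real_1)
  have "pos_real_diag a" "diagonal_mat a" "upper_triangular a"
    using a \<alpha>(1) by (auto simp: a_def pos_real_diag_def diagonal_mat_def mat_diag_def)
  then have aA: "a \<in> A_group n" and aAN: "a \<in> AN_group n"
    using a deta by (auto simp: A_group_def AN_group_def SL_def)
  \<comment> \<open>The sign of \<open>d\<close> alone decides on which side of \<open>l\<close> the
    squared entry lies, which separates the two blocks.\<close>
  have "\<alpha> j < \<alpha> i" if "i < p" "p \<le> j" "j < n" for i j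
  proof -
    have "1 / d (\<pi> j) < 0" "1 / d (\<pi> i) > 0" using pos\<pi> neg\<pi> that by simp_all
    then have "l + 1 / d (\<pi> j) < l + 1 / d (\<pi> i)" by linarith
    then show ?thesis unfolding \<alpha>_def by (rule real_sqrt_less_mono)
  qed
  then have a_adm: "a \<in> A_adm p q"
    using aA by (auto simp: A_adm_def n_def a_def mat_diag_def)
  \<comment> \<open>\<open>T\<close> preserves \<open>J\<close>, but its determinant is only known
    to have modulus 1. The scalar \<open>c\<close> moves it into \<open>SU\<close> and, by
    \<open>congruence_smult\<close>, leaves both congruences unchanged.\<close>
  obtain c where c: "cmod c = 1" "c ^ n = inverse (det T)"
    using unimodular_root[of "inverse (det T)" n] detT n by (auto simp: norm_inverse)
  have "det T \<noteq> 0" using detT by auto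
  then have "det (c \<cdot>\<^sub>m T) = 1" using c T by simp
  moreover have "mat_adjoint (c \<cdot>\<^sub>m T) * J * (c \<cdot>\<^sub>m T) = J"
    using congruence_smult[OF T J(1) c(1)] TJT by simp
  ultimately have "c \<cdot>\<^sub>m T \<in> SU p q"
    using T by (simp add: SU_iff SL_def n_def J_def)
  moreover have "mat_adjoint (c \<cdot>\<^sub>m T) * H * (c \<cdot>\<^sub>m T) = mat_adjoint a * J * a"
    using congruence_smult[OF T H(1) c(1)] THT by simp
  ultimately have "\<exists>g. dressing p q a g b"
    using b aAN by (intro dressing_of_congruence) (simp_all add: H_def J_def n_def)
  with a_adm show ?thesis by (auto simp: AN_adm_def)
qed

theorem proposition4p3:
  fixes p q :: nat and b1 b2 :: "complex mat"
  assumes "p \<ge> 1" and "q \<ge> 1"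
    and "b1 \<in> AN_adm p q" and "b2 \<in> AN_adm p q"
  shows "b1 * b2 \<in> AN_adm p q"
proof -
  have AN: "b1 \<in> AN_group (p + q)" "b2 \<in> AN_group (p + q)"
    using assms(3,4) by (auto simp: AN_adm_def dressing_def)
  then have SL: "b1 \<in> SL (p + q)" "b2 \<in> SL (p + q)" by (auto simp: AN_group_def)
  obtain l1 where l1: "l1 > 0" "dominates p q l1 b1" using AN_adm_dominates[OF assms(1,2,3)] .
  obtain l2 where l2: "l2 > 0" "dominates p q l2 b2" using AN_adm_dominates[OF assms(1,2,4)] .
  have "dominates p q (l1 * l2) (b1 * b2)"
    using l1 l2 SL by (intro dominates_mult)
  then show ?thesis
    using assms(1) AN l1(1) l2(1) by (intro dominates_imp_AN_adm[of _ _ _ "l1 * l2"] AN_group_mult) auto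
qed

end
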